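(* Let $(X,\underline{*},\overline{*})$ be a biquandle, let $P\subset X\times X$ be a subset and $\triangle:P\to X$ a map; write $a\sim b$ if $(a,b)\in P$, and $a\triangle b$ for $\triangle(a,b)$. Suppose $(X,P,\triangle)$ satisfies the primitive conditions (listed in the context). Then: (1) Put $X_1:=\{b\in X \mid \text{there exists } a\in X \text{ such that } a\sim b\}$ and $X_2:=X\setminus X_1$. Then $X_1$ and $X_2$ are subbiquandles of $X$ satisfying, for any $a\in X$, $$X_1\underline{*}a=X_1\overline{*}a=X_1,\qquad X_2\underline{*}a=X_2\overline{*}a=X_2,$$ where $X_i\underline{*}a=\{x\underline{*}a\mid x\in X_i\}$ and $X_i\overline{*}a=\{x\overline{*}a\mid x\in X_i\}$. (2) The relation $\sim$ is an equivalence relation on $X_1$. (3) Let $X_1=\bigsqcup_{\lambda\in\Lambda}G_\lambda$ be the partition of $X_1$ determined by the equivalence relation $\sim$, that is, $a\sim b$ if and only if $a,b\in G_\lambda$ for some $\lambda\in\Lambda$. Then $X_1$ is a multiple conjugation biquandle (that is, the classes $G_\lambda$ carry group structures such that $X_1=\bigsqcup_{\lambda\in\Lambda}G_\lambda$, with the operations $\underline{*},\overline{*}$ restricted from $X$, is a multiple conjugation biquandle).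
   Context: A biquandle is a non-empty set $X$ with binary operations $\underline{*},\overline{*}:X\times X\to X$ such that: (B1) $x\underline{*}x=x\overline{*}x$ for all $x\in X$; (B2) for every $a\in X$ the maps $x\mapsto x\underline{*}a$ and $x\mapsto x\overline{*}a$ are bijections $X\to X$, and the map $S:X\times X\to X\times X$, $S(x,y)=(y\overline{*}x,\,x\underline{*}y)$ is bijective; (B3) for all $x,y,z\in X$: $(x\underline{*}y)\underline{*}(z\underline{*}y)=(x\underline{*}z)\underline{*}(y\overline{*}z)$, $(x\underline{*}y)\overline{*}(z\underline{*}y)=(x\overline{*}z)\underline{*}(y\overline{*}z)$, $(x\overline{*}y)\overline{*}(z\overline{*}y)=(x\overline{*}z)\overline{*}(y\underline{*}z)$. A subbiquandle of $X$ is a subset that is itself a biquandle under the restrictions of $\underline{*},\overline{*}$. Primitive conditions on $(X,P,\triangle)$: (R4) For all $a,b,x\in X$: - [$a\sim b$ and $x=a\triangle b$] $\Leftrightarrow$ [$a\underline{*}b\sim x$ and $(a\underline{*}b)\triangle x=b\overline{*}a$]; - [$a\sim b$ and $x=a\triangle b$] $\Leftrightarrow$ [$a\overline{*}b\sim x$ and $(a\overline{*}b)\triangle x=b\underline{*}a$]. (R5) For all $a,b,x\in X$: - $a\sim b\Leftrightarrow a\underline{*}x\sim b\underline{*}x$, and if these hold then $(x\overline{*}b)\overline{*}(a\triangle b)=x\overline{*}a$ and $(a\triangle b)\underline{*}(x\overline{*}b)=(a\underline{*}x)\triangle(b\underline{*}x)$; - $a\sim b\Leftrightarrow a\overline{*}x\sim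 b\overline{*}x$, and if these hold then $(x\underline{*}b)\underline{*}(a\triangle b)=x\underline{*}a$ and $(a\triangle b)\overline{*}(x\underline{*}b)=(a\overline{*}x)\triangle(b\overline{*}x)$. (R6) For all $a,b,c,x\in X$: - if $a\sim b$, $b\sim c$, $x=b\triangle c$, then $a\sim c$, $a\triangle c\sim x$ and $(a\triangle c)\triangle x=a\triangle b$; - if $a\sim c$ and $a\triangle c\sim x$, then there is a unique $b\in X$ such that $a\sim b$, $b\sim c$, $x=b\triangle c$ and $(a\triangle c)\triangle x=a\triangle b$; - if $a\sim b$, $a\sim c$, $x=a\triangle c$, then $b\sim c$, $x\sim b\triangle c$ and $x\triangle(b\triangle c)=a\triangle b$; - if $b\sim c$ and $x\sim b\triangle c$, then there is a unique $a\in X$ such that $a\sim b$, $a\sim c$, $x=a\triangle c$ and $x\triangle(b\triangle c)=a\triangle b$. A multiple conjugation biquandle is a biquandle $(Y,\underline{*},\overline{*})$ which is a disjoint union of groups $G_\lambda$ ($\lambda\in\Lambda$), where $G_a$ denotes the group $G_\lambda$ containing $a$, such that - for all $a,x\in Y$, $y\mapsto y\underline{*}x$ and $y\mapsto y\overline{*}x$ define group homomorphisms $G_a\to G_{a\underline{*}x}$ and $G_a\to G_{a\overline{*}x}$; - for all $\lambda\in\Lambda$, $a,b\in G_\lambda$ and $x\in Y$: $x\underline{*}(ab)=(x\underline{*}a)\underline{*}(b\overline{*}a)$, $x\overline{*}(ab)=(x\overline{*}a)\overline{*}(b\overline{*}a)$, and $(a^{-1}b)\overline{*}a=(ba^{-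1})\underline{*}a$.
   Formalization: Since biquandles are required to be non-empty, the claims that X_1 and X_2 are subbiquandles and that X_1 is a multiple conjugation biquandle are asserted only when the set in question is non-empty (X_1 or X_2 can be empty). *)

theory Defs
  imports "HOL-Algebra.Group" "HOL-Library.Disjoint_Sets"
begin

(* The operation x \<star>\<^sub>u y is the one written with an underlined star, x \<star>\<^sub>o y the one
   written with an overlined star.  The operations are total functions on the type; only
   their values on the carrier matter.  Closure of the carrier is part of the bijectivity axioms. *)
locale biquandle =
  fixes X :: "'a set"
    and us :: "'a \<Rightarrow> 'a \<Rightarrow> 'a" (infixl "\<star>\<^sub>u" 70)
    and os :: "'a \<Rightarrow> 'a \<Rightarrow> 'a" (infixl "\<star>\<^sub>o" 70)
  assumes nonempty: "X \<noteq> {}"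
    and B1: "x \<in> X \<Longrightarrow> x \<star>\<^sub>u x = x \<star>\<^sub>o x"
    and B2_under: "a \<in> X \<Longrightarrow> bij_betw (\<lambda>x. x \<star>\<^sub>u a) X X"
    and B2_over: "a \<in> X \<Longrightarrow> bij_betw (\<lambda>x. x \<star>\<^sub>o a) X X"
    and B2_S: "bij_betw (\<lambda>(x, y). (y \<star>\<^sub>o x, x \<star>\<^sub>u y)) (X \<times> X) (X \<times> X)"
    and B3_1: "\<lbrakk>x \<in> X; y \<in> X; z \<in> X\<rbrakk> \<Longrightarrow>
      (x \<star>\<^sub>u y) \<star>\<^sub>u (z \<star>\<^sub>u y) = (x \<star>\<^sub>u z) \<star>\<^sub>u (y \<star>\<^sub>o z)"
    and B3_2: "\<lbrakk>x \<in> X; y \<in> X; z \<in> X\<rbrakk> \<Longrightarrow>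
      (x \<star>\<^sub>u y) \<star>\<^sub>o (z \<star>\<^sub>u y) = (x \<star>\<^sub>o z) \<star>\<^sub>u (y \<star>\<^sub>o z)"
    and B3_3: "\<lbrakk>x \<in> X; y \<in> X; z \<in> X\<rbrakk> \<Longrightarrow>
      (x \<star>\<^sub>o y) \<star>\<^sub>o (z \<star>\<^sub>o y) = (x \<star>\<^sub>o z) \<star>\<^sub>o (y \<star>\<^sub>u z)"

definition subbiquandle ::
    "'a set \<Rightarrow> 'a set \<Rightarrow> ('a \<Rightarrow> 'a \<Rightarrow> 'a) \<Rightarrow> ('a \<Rightarrow> 'a \<Rightarrow> 'a) \<Rightarrow> bool" where
  "subbiquandle A X us os \<longleftrightarrow> A \<subseteq> X \<and> biquandle A us os"

(* The partial operation P \<rightarrow> X is a total function tri whose values are used on P only. *)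
locale biquandle_partial_operation = biquandle X us os
  for X :: "'a set"
    and us :: "'a \<Rightarrow> 'a \<Rightarrow> 'a" (infixl "\<star>\<^sub>u" 70)
    and os :: "'a \<Rightarrow> 'a \<Rightarrow> 'a" (infixl "\<star>\<^sub>o" 70) +
  fixes P :: "('a \<times> 'a) set"
    and tri :: "'a \<Rightarrow> 'a \<Rightarrow> 'a" (infixl "\<triangle>" 70)
  assumes P_subset: "P \<subseteq> X \<times> X"
    and tri_closed: "(a, b) \<in> P \<Longrightarrow> a \<triangle> b \<in> X"
begin

abbreviation sim :: "'a \<Rightarrow> 'a \<Rightarrow> bool" (infix "\<sim>" 50) where
  "a \<sim> b \<equiv> (a, b) \<in> P"

end

locale primitive_biquandle = biquandle_partial_operation +
  assumes R4_1: "\<lbrakk>a \<in> X; b \<in> X; x \<in> X\<rbrakk> \<Longrightarrow>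
      (a \<sim> b \<and> x = a \<triangle> b) \<longleftrightarrow> (a \<star>\<^sub>u b \<sim> x \<and> (a \<star>\<^sub>u b) \<triangle> x = b \<star>\<^sub>o a)"
    and R4_2: "\<lbrakk>a \<in> X; b \<in> X; x \<in> X\<rbrakk> \<Longrightarrow>
      (a \<sim> b \<and> x = a \<triangle> b) \<longleftrightarrow> (a \<star>\<^sub>o b \<sim> x \<and> (a \<star>\<^sub>o b) \<triangle> x = b \<star>\<^sub>u a)"
    and R5_1: "\<lbrakk>a \<in> X; b \<in> X; x \<in> X\<rbrakk> \<Longrightarrow>
      (a \<sim> b \<longleftrightarrow> a \<star>\<^sub>u x \<sim> b \<star>\<^sub>u x) \<and>
      (a \<sim> b \<longrightarrow> (x \<star>\<^sub>o b) \<star>\<^sub>o (a \<triangle> b) = x \<star>\<^sub>o a \<and>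
                 (a \<triangle> b) \<star>\<^sub>u (x \<star>\<^sub>o b) = (a \<star>\<^sub>u x) \<triangle> (b \<star>\<^sub>u x))"
    and R5_2: "\<lbrakk>a \<in> X; b \<in> X; x \<in> X\<rbrakk> \<Longrightarrow>
      (a \<sim> b \<longleftrightarrow> a \<star>\<^sub>o x \<sim> b \<star>\<^sub>o x) \<and>
      (a \<sim> b \<longrightarrow> (x \<star>\<^sub>u b) \<star>\<^sub>u (a \<triangle> b) = x \<star>\<^sub>u a \<and>
                 (a \<triangle> b) \<star>\<^sub>o (x \<star>\<^sub>u b) = (a \<star>\<^sub>o x) \<triangle> (b \<star>\<^sub>o x))"
    and R6_1: "\<lbrakk>a \<in> X; b \<in> X; c \<in> X; x \<in> X; a \<sim> b; b \<sim> c; x = b \<triangle> c\<rbrakk> \<Longrightarrow>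
      a \<sim> c \<and> a \<triangle> c \<sim> x \<and> (a \<triangle> c) \<triangle> x = a \<triangle> b"
    and R6_2: "\<lbrakk>a \<in> X; c \<in> X; x \<in> X; a \<sim> c; a \<triangle> c \<sim> x\<rbrakk> \<Longrightarrow>
      \<exists>!b. b \<in> X \<and> a \<sim> b \<and> b \<sim> c \<and> x = b \<triangle> c \<and> (a \<triangle> c) \<triangle> x = a \<triangle> b"
    and R6_3: "\<lbrakk>a \<in> X; b \<in> X; c \<in> X; x \<in> X; a \<sim> b; a \<sim> c; x = a \<triangle> c\<rbrakk> \<Longrightarrow>
      b \<sim> c \<and> x \<sim> b \<triangle> c \<and> x \<triangle> (b \<triangle> c) = a \<triangle> b"
    and R6_4: "\<lbrakk>b \<in> X; c \<in> X; x \<in> X; b \<sim> c; x \<sim> b \<triangle> c\<rbrakk> \<Longrightarrow>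
      \<exists>!a. a \<in> X \<and> a \<sim> b \<and> a \<sim> c \<and> x = a \<triangle> c \<and> x \<triangle> (b \<triangle> c) = a \<triangle> b"

(* In hom_under and hom_over, G l is the group containing a and G m the one containing
   a \<star>\<^sub>u x resp. a \<star>\<^sub>o x; such l and m exist and are unique because the carriers partition Y. *)
locale multiple_conjugation_biquandle = biquandle Y us os
  for Y :: "'a set"
    and us :: "'a \<Rightarrow> 'a \<Rightarrow> 'a" (infixl "\<star>\<^sub>u" 70)
    and os :: "'a \<Rightarrow> 'a \<Rightarrow> 'a" (infixl "\<star>\<^sub>o" 70) +
  fixes \<Lambda> :: "'i set"
    and G :: "'i \<Rightarrow> 'a monoid"
  assumes groups: "l \<in> \<Lambda> \<Longrightarrow> group (G l)"
    and disjoint: "disjoint_family_on (\<lambda>l. carrier (G l)) \<Lambda>"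
    and union: "(\<Union>l\<in>\<Lambda>. carrier (G l)) = Y"
    and hom_under: "\<lbrakk>l \<in> \<Lambda>; m \<in> \<Lambda>; x \<in> Y; a \<in> carrier (G l); a \<star>\<^sub>u x \<in> carrier (G m)\<rbrakk> \<Longrightarrow>
      (\<lambda>y. y \<star>\<^sub>u x) \<in> hom (G l) (G m)"
    and hom_over: "\<lbrakk>l \<in> \<Lambda>; m \<in> \<Lambda>; x \<in> Y; a \<in> carrier (G l); a \<star>\<^sub>o x \<in> carrier (G m)\<rbrakk> \<Longrightarrow>
      (\<lambda>y. y \<star>\<^sub>o x) \<in> hom (G l) (G m)"
    and under_mult: "\<lbrakk>l \<in> \<Lambda>; a \<in> carrier (G l); b \<in> carrier (G l); x \<in> Y\<rbrakk> \<Longrightarrow>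
      x \<star>\<^sub>u (a \<otimes>\<^bsub>G l\<^esub> b) = (x \<star>\<^sub>u a) \<star>\<^sub>u (b \<star>\<^sub>o a)"
    and over_mult: "\<lbrakk>l \<in> \<Lambda>; a \<in> carrier (G l); b \<in> carrier (G l); x \<in> Y\<rbrakk> \<Longrightarrow>
      x \<star>\<^sub>o (a \<otimes>\<^bsub>G l\<^esub> b) = (x \<star>\<^sub>o a) \<star>\<^sub>o (b \<star>\<^sub>o a)"
    and inv_mult: "\<lbrakk>l \<in> \<Lambda>; a \<in> carrier (G l); b \<in> carrier (G l)\<rbrakk> \<Longrightarrow>
      (inv\<^bsub>G l\<^esub> a \<otimes>\<^bsub>G l\<^esub> b) \<star>\<^sub>o a = (b \<otimes>\<^bsub>G l\<^esub> inv\<^bsub>G l\<^esub> a) \<star>\<^sub>u a"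

end

theory Submission
  imports Defs
begin

text \<open>
  In a multiple conjugation biquandle $a \triangle b = (b^{-1}a) \mathbin{\overline{*}} b
  = (ab^{-1}) \mathbin{\underline{*}} b$.  Reading this backwards, the product $bc$ is the unique
  $a \sim b$ with $a \triangle b = c \mathbin{\overline{*}} b$.  It exists because
  $a \mapsto a \triangle b$ and $c \mapsto c \mathbin{\overline{*}} b$ are bijections from the class
  of $b$ onto one and the same class.  By (R4) and (R6) the defining equation is equivalent to
  $a \triangle c = b \mathbin{\underline{*}} c$, so both translations are bijective and it remains
  to check associativity to get a group.
\<close>

section \<open>Invariant subsets of a biquandle\<close>

context biquandle
begin

lemma under_closed [simp, intro]: "x \<star>\<^sub>u a \<in> X" if "x \<in> X" "a \<in> X"
  using B2_under[OF that(2)] that(1) by (auto simp: bij_betw_def)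

lemma over_closed [simp, intro]: "x \<star>\<^sub>o a \<in> X" if "x \<in> X" "a \<in> X"
  using B2_over[OF that(2)] that(1) by (auto simp: bij_betw_def)

lemma under_surj:
  assumes "y \<in> X" "a \<in> X"
  obtains x where "x \<in> X" "y = x \<star>\<^sub>u a"
  using assms B2_under[of a] by (auto simp: bij_betw_def)

lemma over_surj:
  assumes "y \<in> X" "a \<in> X"
  obtains x where "x \<in> X" "y = x \<star>\<^sub>o a"
  using assms B2_over[of a] by (auto simp: bij_betw_def)

text \<open>Two-sided invariance is required: a point of \<open>A\<close> has a preimage in
  \<open>X\<close>, and only the implication from the image back to \<open>x\<close> places that
  preimage in \<open>A\<close>.\<close>

lemma under_image:
  assumes "A \<subseteq> X" "a \<in> X" and inv: "\<And>x. x \<in> X \<Longrightarrow> x \<star>\<^sub>u a \<in> A \<longleftrightarrow> x \<in> A"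
  shows "(\<lambda>x. x \<star>\<^sub>u a) ` A = A"
proof (intro equalityI subsetI)
  fix y assume "y \<in> (\<lambda>x. x \<star>\<^sub>u a) ` A"
  then obtain x where "x \<in> A" "y = x \<star>\<^sub>u a" by (rule imageE)
  then show "y \<in> A" using inv[of x] assms(1) by auto
next
  fix y assume y: "y \<in> A"
  then have "y \<in> X" using assms(1) by (rule subsetD[rotated])
  then obtain x where x: "x \<in> X" "y = x \<star>\<^sub>u a" using \<open>a \<in> X\<close> by (rule under_surj)
  then have "x \<in> A" using inv[of x] y by simp
  then show "y \<in> (\<lambda>x. x \<star>\<^sub>u a) ` A" using x(2) by (simp add: image_eqI)
qed

lemma over_image:
  assumes "A \<subseteq> X" "a \<in> X" and inv: "\<And>x. x \<in> X \<Longrightarrow> x \<star>\<^sub>o a \<in> A \<longleftrightarrow> x \<in> A"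
  shows "(\<lambda>x. x \<star>\<^sub>o a) ` A = A"
proof (intro equalityI subsetI)
  fix y assume "y \<in> (\<lambda>x. x \<star>\<^sub>o a) ` A"
  then obtain x where "x \<in> A" "y = x \<star>\<^sub>o a" by (rule imageE)
  then show "y \<in> A" using inv[of x] assms(1) by auto
next
  fix y assume y: "y \<in> A"
  then have "y \<in> X" using assms(1) by (rule subsetD[rotated])
  then obtain x where x: "x \<in> X" "y = x \<star>\<^sub>o a" using \<open>a \<in> X\<close> by (rule over_surj)
  then have "x \<in> A" using inv[of x] y by simp
  then show "y \<in> (\<lambda>x. x \<star>\<^sub>o a) ` A" using x(2) by (simp add: image_eqI)
qed

text \<open>The identities restrict to \<open>A\<close>, and so does injectivity of the translations
  and of the map \<open>S\<close>. Only surjectivity onto \<open>A\<close> needs an argument, and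
  two-sided invariance supplies it.\<close>

lemma subbiquandleI:
  assumes "A \<noteq> {}" and AX: "A \<subseteq> X"
    and under: "\<And>x a. x \<in> X \<Longrightarrow> a \<in> X \<Longrightarrow> x \<star>\<^sub>u a \<in> A \<longleftrightarrow> x \<in> A"
    and over: "\<And>x a. x \<in> X \<Longrightarrow> a \<in> X \<Longrightarrow> x \<star>\<^sub>o a \<in> A \<longleftrightarrow> x \<in> A"
  shows "subbiquandle A X us os"
  unfolding subbiquandle_def
proof (intro conjI AX biquandle.intro)
  note in_X = subsetD[OF AX]
  let ?S = "\<lambda>(x, y). (y \<star>\<^sub>o x, x \<star>\<^sub>u y)"
  show "bij_betw (\<lambda>x. x \<star>\<^sub>u a) A A" if "a \<in> A" for a
    using in_X[OF that] by (intro bij_betw_subset[OF B2_under AX] under_image AX under)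
  show "bij_betw (\<lambda>x. x \<star>\<^sub>o a) A A" if "a \<in> A" for a
    using in_X[OF that] by (intro bij_betw_subset[OF B2_over AX] over_image AX over)
  show "bij_betw ?S (A \<times> A) (A \<times> A)"
  proof (rule bij_betw_subset[OF B2_S])
    show "A \<times> A \<subseteq> X \<times> X" using AX AX by (rule Sigma_mono)
    show "?S ` (A \<times> A) = A \<times> A"
    proof (intro equalityI subsetI)
      fix p assume "p \<in> ?S ` (A \<times> A)"
      then obtain x y where "x \<in> A" "y \<in> A" "p = (y \<star>\<^sub>o x, x \<star>\<^sub>u y)" by auto
      then show "p \<in> A \<times> A" by (simp add: under over in_X)
    next
      fix p assume p: "p \<in> A \<times> A"
      then have "p \<in> ?S ` (X \<times> X)"
        using bij_betw_imp_surj_on[OF B2_S] AX by auto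
      then obtain x y where xy: "x \<in> X" "y \<in> X" "p = (y \<star>\<^sub>o x, x \<star>\<^sub>u y)" by auto
      \<comment> \<open>Invariance concerns the left operand: the first entry of \<open>p\<close>
        controls \<open>y\<close>, the second controls \<open>x\<close>.\<close>
      then have "(x, y) \<in> A \<times> A" using p by (simp add: under over)
      then show "p \<in> ?S ` (A \<times> A)" using xy(3) by (simp add: image_eqI[of _ _ "(x, y)"])
    qed
  qed
qed (simp_all add: assms(1) subsetD[OF AX] B1 B3_1 B3_2 B3_3)

end

section \<open>The relation as an equivalence on its support\<close>

context primitive_biquandle
begin

definition support :: "'a set" where
  "support = {b \<in> X. \<exists>a \<in> X. a \<sim> b}"

lemma sim_closed: "a \<sim> b \<Longrightarrow> a \<in> X \<and> b \<in> X"
  using P_subset by auto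

lemma support_closed: "a \<in> support \<Longrightarrow> a \<in> X"
  by (simp add: support_def)

text \<open>Third clause of (R6) with \<open>c = b\<close>.\<close>

lemma sim_refl_right: "a \<sim> b \<Longrightarrow> b \<sim> b"
  using R6_3[of a b b "a \<triangle> b"] sim_closed tri_closed by blast

text \<open>In this form, invariance of the support is a special case of the invariance of
  \<open>\<sim>\<close> in (R5).\<close>

lemma support_iff: "a \<in> support \<longleftrightarrow> a \<sim> a"
  unfolding support_def using sim_refl_right sim_closed by blast

lemma under_sim_tri: "a \<sim> b \<Longrightarrow> a \<star>\<^sub>u b \<sim> a \<triangle> b \<and> (a \<star>\<^sub>u b) \<triangle> (a \<triangle> b) = b \<star>\<^sub>o a"
  using R4_1[of a b "a \<triangle> b"] sim_closed tri_closed by blast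

lemma over_sim_tri: "a \<sim> b \<Longrightarrow> a \<star>\<^sub>o b \<sim> a \<triangle> b \<and> (a \<star>\<^sub>o b) \<triangle> (a \<triangle> b) = b \<star>\<^sub>u a"
  using R4_2[of a b "a \<triangle> b"] sim_closed tri_closed by blast

text \<open>With \<open>\<triangle>\<close> read as right division up to a twist, this is the
  cancellation (a c^{-1})(b c^{-1})^{-1} = a b^{-1}.\<close>

lemma tri_tri: "a \<sim> b \<Longrightarrow> a \<sim> c \<Longrightarrow> a \<triangle> c \<sim> b \<triangle> c \<and> (a \<triangle> c) \<triangle> (b \<triangle> c) = a \<triangle> b"
  using R6_3[of a b c "a \<triangle> c"] sim_closed tri_closed by blast

text \<open>Uniqueness in the fourth clause of (R6), taken with \<open>b = c\<close>.\<close>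

lemma tri_cancel:
  assumes "a \<sim> c" "b \<sim> c" "a \<triangle> c = b \<triangle> c"
  shows "a = b"
proof -
  have c: "c \<sim> c" using assms sim_refl_right by blast
  have "\<exists>!d. d \<in> X \<and> d \<sim> c \<and> d \<sim> c \<and> a \<triangle> c = d \<triangle> c \<and> (a \<triangle> c) \<triangle> (c \<triangle> c) = d \<triangle> c"
    using R6_4[of c c "a \<triangle> c"] tri_tri[of a c c] assms c sim_closed tri_closed by blast
  \<comment> \<open>This turns the last condition on \<open>d\<close> into
    \<open>a \<triangle> c = d \<triangle> c\<close>, so \<open>a\<close> and \<open>b\<close> both
    meet the description.\<close>
  moreover have "(a \<triangle> c) \<triangle> (c \<triangle> c) = a \<triangle> c" using tri_tri assms by blast
  ultimately show ?thesis using assms sim_closed by metis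
qed

lemma tri_surj:
  assumes "c \<sim> c" "x \<sim> c \<triangle> c"
  obtains a where "a \<sim> c" "x = a \<triangle> c"
  using R6_4[of c c x] assms sim_closed by blast

text \<open>(R6) solves \<open>a \<triangle> b = d \<triangle> b\<close> for some \<open>d\<close> with \<open>a \<sim> d\<close>; by cancellation \<open>d\<close> is \<open>a\<close>.\<close>

lemma sim_refl_left:
  assumes "a \<sim> b"
  shows "a \<sim> a"
proof -
  have "a \<triangle> b \<sim> a \<triangle> b" using under_sim_tri[OF assms] sim_refl_right by blast
  then obtain d where "a \<sim> d" "d \<sim> b" "a \<triangle> b = d \<triangle> b"
    using R6_2[of a b "a \<triangle> b"] assms sim_closed by blast
  then show ?thesis using tri_cancel assms by blast
qed

text \<open>Third clause of (R6) with \<open>c = a\<close>; it takes \<open>a \<sim> a\<close> as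
  input, so left reflexivity comes first.\<close>

lemma sim_sym: "a \<sim> b \<Longrightarrow> b \<sim> a"
  using R6_3[of a b a "a \<triangle> a"] sim_refl_left sim_closed tri_closed by blast

lemma sim_trans [trans]: "a \<sim> b \<Longrightarrow> b \<sim> c \<Longrightarrow> a \<sim> c"
  using R6_1[of a b c "b \<triangle> c"] sim_closed tri_closed by blast

lemma equiv_support: "equiv support P"
proof (rule equivI)
  show "P \<subseteq> support \<times> support"
    using sim_refl_left sim_refl_right support_iff by auto
  show "refl_on support P"
    by (simp add: refl_on_def support_iff)
  show "sym P" by (blast intro: symI sim_sym)
  show "trans P" by (blast intro: transI sim_trans)
qed

section \<open>Compatibility with translations, from (R5)\<close>

lemma sim_under_iff: "\<lbrakk>a \<in> X; b \<in> X; x \<in> X\<rbrakk> \<Longrightarrow> a \<star>\<^sub>u x \<sim> b \<star>\<^sub>u x \<longleftrightarrow> a \<sim> b"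
  using R5_1[of a b x] by blast

lemma sim_over_iff: "\<lbrakk>a \<in> X; b \<in> X; x \<in> X\<rbrakk> \<Longrightarrow> a \<star>\<^sub>o x \<sim> b \<star>\<^sub>o x \<longleftrightarrow> a \<sim> b"
  using R5_2[of a b x] by blast

lemma over_over_tri: "a \<sim> b \<Longrightarrow> x \<in> X \<Longrightarrow> (x \<star>\<^sub>o b) \<star>\<^sub>o (a \<triangle> b) = x \<star>\<^sub>o a"
  using R5_1[of a b x] sim_closed[of a b] by blast

lemma under_under_tri: "a \<sim> b \<Longrightarrow> x \<in> X \<Longrightarrow> (x \<star>\<^sub>u b) \<star>\<^sub>u (a \<triangle> b) = x \<star>\<^sub>u a"
  using R5_2[of a b x] sim_closed[of a b] by blast

lemma tri_under: "a \<sim> b \<Longrightarrow> x \<in> X \<Longrightarrow> (a \<triangle> b) \<star>\<^sub>u (x \<star>\<^sub>o b) = (a \<star>\<^sub>u x) \<triangle> (b \<star>\<^sub>u x)"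
  using R5_1[of a b x] sim_closed[of a b] by blast

lemma tri_over: "a \<sim> b \<Longrightarrow> x \<in> X \<Longrightarrow> (a \<triangle> b) \<star>\<^sub>o (x \<star>\<^sub>u b) = (a \<star>\<^sub>o x) \<triangle> (b \<star>\<^sub>o x)"
  using R5_2[of a b x] sim_closed[of a b] by blast

lemma support_under_iff: "x \<in> X \<Longrightarrow> a \<in> X \<Longrightarrow> x \<star>\<^sub>u a \<in> support \<longleftrightarrow> x \<in> support"
  by (simp add: support_iff sim_under_iff)

lemma support_over_iff: "x \<in> X \<Longrightarrow> a \<in> X \<Longrightarrow> x \<star>\<^sub>o a \<in> support \<longleftrightarrow> x \<in> support"
  by (simp add: support_iff sim_over_iff)

section \<open>The product relation: existence, uniqueness and division\<close>

text \<open>\<open>is_prod b c a\<close> says that \<open>a\<close> is the product of \<open>b\<close> and \<open>c\<close>.\<close>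

definition is_prod :: "'a \<Rightarrow> 'a \<Rightarrow> 'a \<Rightarrow> bool" where
  "is_prod b c a \<longleftrightarrow> a \<sim> b \<and> c \<sim> b \<and> a \<triangle> b = c \<star>\<^sub>o b"

lemma is_prod_sim:
  assumes "is_prod b c a"
  shows "a \<sim> b" "c \<sim> b" "a \<sim> c"
  using assms sim_trans sim_sym unfolding is_prod_def by blast+

text \<open>Applying \<open>\<triangle> (c \<triangle> b)\<close> sends
  \<open>a \<triangle> b\<close> to \<open>a \<triangle> c\<close> by (R6) and
  \<open>c \<star>\<^sub>o b\<close> to \<open>b \<star>\<^sub>u c\<close> by (R4); applying
  \<open>\<triangle> (b \<triangle> c)\<close> sends both back. So either equation implies the
  other.\<close>

lemma is_prod_iff_under: "is_prod b c a \<longleftrightarrow> a \<sim> c \<and> b \<sim> c \<and> a \<triangle> c = b \<star>\<^sub>u c"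
proof -
  have "a \<triangle> b = c \<star>\<^sub>o b \<longleftrightarrow> a \<triangle> c = b \<star>\<^sub>u c" if "a \<sim> b" "a \<sim> c" "b \<sim> c"
    using that tri_tri[of a b c] tri_tri[of a c b]
      under_sim_tri[of b c] over_sim_tri[OF sim_sym[of b c]] by metis
  then show ?thesis
    unfolding is_prod_def using sim_trans sim_sym by blast
qed

lemma is_prod_exists:
  assumes "c \<sim> b"
  shows "\<exists>a. is_prod b c a"
proof -
  have b: "b \<sim> b" "b \<in> X" "c \<in> X" using assms sim_refl_right sim_closed by auto
  \<comment> \<open>By \<open>tri_surj\<close> the values \<open>a \<triangle> b\<close> with
    \<open>a \<sim> b\<close> fill the class of \<open>b \<triangle> b\<close>, so it is enough to
    place \<open>c \<star>\<^sub>o b\<close> in that class.\<close>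
  have "c \<star>\<^sub>o b \<sim> b \<star>\<^sub>o b" using assms b sim_over_iff by blast
  also have "b \<star>\<^sub>o b \<sim> b \<triangle> b" using over_sim_tri b by blast
  finally obtain a where "a \<sim> b" "c \<star>\<^sub>o b = a \<triangle> b" using tri_surj b by blast
  then show ?thesis using assms by (auto simp: is_prod_def)
qed

lemma is_prod_unique: "is_prod b c a \<Longrightarrow> is_prod b c a' \<Longrightarrow> a = a'"
  using tri_cancel unfolding is_prod_def by metis

text \<open>The unknown \<open>b\<close> in \<open>a \<triangle> c = b \<star>\<^sub>u c\<close> is
  found by inverting a translation of \<open>X\<close>. It lands in the class of \<open>c\<close>
  because \<open>a \<triangle> c\<close> and \<open>c \<star>\<^sub>u c\<close> are both related to
  \<open>c \<triangle> c\<close>.\<close>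

lemma is_prod_left_factor:
  assumes "a \<sim> c"
  shows "\<exists>b. is_prod b c a"
proof -
  have c: "c \<sim> c" "c \<in> X" "a \<in> X" using assms sim_refl_right sim_closed by auto
  have *: "a \<triangle> c \<sim> c \<star>\<^sub>u c"
    using tri_tri[OF assms assms] under_sim_tri[OF c(1)] sim_sym sim_trans by blast
  then obtain b where b: "b \<in> X" "a \<triangle> c = b \<star>\<^sub>u c"
    using under_surj[of "a \<triangle> c" c] sim_closed c by blast
  then have "b \<sim> c" using * c sim_under_iff by auto
  then show ?thesis using assms b is_prod_iff_under by blast
qed

lemma is_prod_right_factor:
  assumes "a \<sim> b"
  shows "\<exists>c. is_prod b c a"
proof -
  have b: "b \<sim> b" "b \<in> X" "a \<in> X" using assms sim_refl_right sim_closed by auto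
  have *: "a \<triangle> b \<sim> b \<star>\<^sub>o b"
    using tri_tri[OF assms assms] over_sim_tri[OF b(1)] sim_sym sim_trans by blast
  then obtain c where c: "c \<in> X" "a \<triangle> b = c \<star>\<^sub>o b"
    using over_surj[of "a \<triangle> b" b] sim_closed b by blast
  then have "c \<sim> b" using * b sim_over_iff by auto
  then show ?thesis using assms c is_prod_def by blast
qed

section \<open>Associativity and multiplicativity of the translations\<close>

text \<open>Here d = ab, f = dc, g = bc. Both \<open>f \<triangle> a\<close> and
  \<open>g \<star>\<^sub>o a\<close> become \<open>c \<star>\<^sub>o d\<close> under
  \<open>\<triangle> (b \<star>\<^sub>o a)\<close>: the first by (R6), since
  \<open>d \<triangle> a = b \<star>\<^sub>o a\<close>, the second by (R5) and (B3). Cancellation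
  then gives f = ag.\<close>

lemma is_prod_assoc:
  assumes d: "is_prod a b d" and f: "is_prod d c f" and g: "is_prod b c g"
  shows "is_prod a g f"
proof -
  have X: "a \<in> X" "b \<in> X" "c \<in> X" "d \<in> X" "f \<in> X" "g \<in> X"
    using assms is_prod_sim sim_closed by blast+
  have sim: "d \<sim> a" "b \<sim> a" "f \<sim> d" "g \<sim> b" "f \<sim> a" "g \<sim> a"
    using assms is_prod_sim sim_trans by blast+
  have eqs: "d \<triangle> a = b \<star>\<^sub>o a" "f \<triangle> d = c \<star>\<^sub>o d" "g \<triangle> b = c \<star>\<^sub>o b"
    using assms by (auto simp: is_prod_def)
  have "(f \<triangle> a) \<triangle> (b \<star>\<^sub>o a) = c \<star>\<^sub>o d"
    using tri_tri[OF sim(3,5)] eqs by simp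
  also have "\<dots> = (c \<star>\<^sub>o a) \<star>\<^sub>o (b \<star>\<^sub>o a)"
    using over_over_tri[OF sim(1), of c] X eqs by simp
  also have "\<dots> = (c \<star>\<^sub>o b) \<star>\<^sub>o (a \<star>\<^sub>u b)"
    using B3_3 X by blast
  also have "\<dots> = (g \<star>\<^sub>o a) \<triangle> (b \<star>\<^sub>o a)"
    using tri_over[OF sim(4), of a] X eqs by simp
  \<comment> \<open>Cancellation applies since both elements are related to
    \<open>b \<star>\<^sub>o a\<close>.\<close>
  finally have "f \<triangle> a = g \<star>\<^sub>o a"
    using tri_cancel tri_tri[OF sim(3,5)] eqs(1) sim_over_iff X sim(4) by metis
  then show ?thesis using sim by (simp add: is_prod_def)
qed

text \<open>Translation by \<open>x\<close> transforms the two sides of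
  \<open>a \<triangle> b = c \<star>\<^sub>o b\<close> alike, the left by (R5) and the right by
  (B3). This yields the homomorphism axiom.\<close>

lemma is_prod_under:
  assumes "is_prod b c a" "x \<in> X"
  shows "is_prod (b \<star>\<^sub>u x) (c \<star>\<^sub>u x) (a \<star>\<^sub>u x)"
proof -
  have X: "a \<in> X" "b \<in> X" "c \<in> X" using assms is_prod_sim sim_closed by blast+
  have "(a \<star>\<^sub>u x) \<triangle> (b \<star>\<^sub>u x) = (c \<star>\<^sub>o b) \<star>\<^sub>u (x \<star>\<^sub>o b)"
    using assms tri_under[of a b x] by (simp add: is_prod_def)
  also have "\<dots> = (c \<star>\<^sub>u x) \<star>\<^sub>o (b \<star>\<^sub>u x)"
    using B3_2 X assms(2) by metis
  finally show ?thesis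
    using assms X by (simp add: is_prod_def sim_under_iff)
qed

lemma is_prod_over:
  assumes "is_prod b c a" "x \<in> X"
  shows "is_prod (b \<star>\<^sub>o x) (c \<star>\<^sub>o x) (a \<star>\<^sub>o x)"
proof -
  have X: "a \<in> X" "b \<in> X" "c \<in> X" using assms is_prod_sim sim_closed by blast+
  have "(a \<star>\<^sub>o x) \<triangle> (b \<star>\<^sub>o x) = (c \<star>\<^sub>o b) \<star>\<^sub>o (x \<star>\<^sub>u b)"
    using assms tri_over[of a b x] by (simp add: is_prod_def)
  also have "\<dots> = (c \<star>\<^sub>o x) \<star>\<^sub>o (b \<star>\<^sub>o x)"
    using B3_3 X assms(2) by metis
  finally show ?thesis
    using assms X by (simp add: is_prod_def sim_over_iff)
qed

section \<open>The group structure on a class\<close>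

definition prd :: "'a \<Rightarrow> 'a \<Rightarrow> 'a" where
  "prd b c = (THE a. is_prod b c a)"

lemma prd_eq: "is_prod b c a \<Longrightarrow> prd b c = a"
  unfolding prd_def using is_prod_unique by blast

text \<open>\<open>prd\<close> is meaningful on related pairs, hence within a class. The unit is
  chosen merely as a left identity, which becomes two-sided once left inverses and associativity are
  known.\<close>

definition class_group :: "'a set \<Rightarrow> 'a monoid" where
  "class_group C = \<lparr>carrier = C, monoid.mult = prd, one = (SOME e. e \<in> C \<and> (\<forall>c\<in>C. prd e c = c))\<rparr>"

lemma carrier_class_group [simp]: "carrier (class_group C) = C"
  by (simp add: class_group_def)

lemma mult_class_group [simp]: "b \<otimes>\<^bsub>class_group C\<^esub> c = prd b c"
  by (simp add: class_group_def)

lemma class_sim: "C \<in> support // P \<Longrightarrow> a \<in> C \<Longrightarrow> b \<in> C \<longleftrightarrow> a \<sim> b"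
  by (blast elim!: quotientE intro: sim_sym sim_trans)

lemma class_is_prod:
  assumes "C \<in> support // P" "b \<in> C" "c \<in> C"
  shows "is_prod b c (prd b c)" "prd b c \<in> C"
proof -
  have "c \<sim> b" using assms class_sim by blast
  then show *: "is_prod b c (prd b c)" using is_prod_exists prd_eq by blast
  show "prd b c \<in> C" using is_prod_sim[OF *] assms class_sim sim_sym by blast
qed

text \<open>Solve ea = a for a single a. Every c in the class has the form ad, so ec = e(ad) = (ea)d
  = ad = c.\<close>

lemma class_left_identity:
  assumes "C \<in> support // P"
  shows "\<exists>e\<in>C. \<forall>c\<in>C. prd e c = c"
proof -
  obtain a where a: "a \<in> C" "a \<sim> a"
    using assms equiv_class_self[OF equiv_support] support_iff by (auto elim!: quotientE)
  then obtain e where e: "is_prod e a a" using is_prod_left_factor by blast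
  then have "e \<in> C" using a(1) assms class_sim is_prod_sim by blast
  moreover have "prd e c = c" if "c \<in> C" for c
  proof -
    have "c \<sim> a" using that a assms class_sim by blast
    then obtain d where d: "is_prod a d c" using is_prod_right_factor by blast
    then have "is_prod e c c" using is_prod_assoc[OF e d d] by blast
    then show ?thesis using prd_eq by blast
  qed
  ultimately show ?thesis by blast
qed

lemma one_class_group:
  assumes "C \<in> support // P"
  shows "\<one>\<^bsub>class_group C\<^esub> \<in> C" "c \<in> C \<Longrightarrow> prd \<one>\<^bsub>class_group C\<^esub> c = c"
  using someI_ex[of "\<lambda>e. e \<in> C \<and> (\<forall>c\<in>C. prd e c = c)"] class_left_identity[OF assms]
  by (auto simp: class_group_def)

lemma group_class_group:
  assumes C: "C \<in> support // P"
  shows "group (class_group C)"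
proof (rule groupI)
  show "\<one>\<^bsub>class_group C\<^esub> \<in> carrier (class_group C)" using one_class_group[OF C] by simp
  show "b \<otimes>\<^bsub>class_group C\<^esub> c \<in> carrier (class_group C)"
    if "b \<in> carrier (class_group C)" "c \<in> carrier (class_group C)" for b c
    using that class_is_prod[OF C] by simp
  show "\<one>\<^bsub>class_group C\<^esub> \<otimes>\<^bsub>class_group C\<^esub> c = c" if "c \<in> carrier (class_group C)" for c
    using that one_class_group[OF C] by simp
  show "(a \<otimes>\<^bsub>class_group C\<^esub> b) \<otimes>\<^bsub>class_group C\<^esub> c = a \<otimes>\<^bsub>class_group C\<^esub> (b \<otimes>\<^bsub>class_group C\<^esub> c)"
    if "a \<in> carrier (class_group C)" "b \<in> carrier (class_group C)" "c \<in> carrier (class_group C)"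
    for a b c
  proof -
    have abc: "a \<in> C" "b \<in> C" "c \<in> C" using that by auto
    have "is_prod a (prd b c) (prd (prd a b) c)"
      using is_prod_assoc class_is_prod[OF C] abc by blast
    then show ?thesis by (simp add: prd_eq)
  qed
  show "\<exists>b\<in>carrier (class_group C). b \<otimes>\<^bsub>class_group C\<^esub> c = \<one>\<^bsub>class_group C\<^esub>"
    if "c \<in> carrier (class_group C)" for c
  proof -
    have c: "c \<in> C" using that by simp
    then have "\<one>\<^bsub>class_group C\<^esub> \<sim> c" using one_class_group[OF C] class_sim[OF C] by blast
    \<comment> \<open>The left inverse is the left factor in a factorisation of the unit with right
      factor \<open>c\<close>.\<close>
    then obtain b where b: "is_prod b c \<one>\<^bsub>class_group C\<^esub>" using is_prod_left_factor by blast
    then have "b \<in> C" using c class_sim[OF C] is_prod_sim by blast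
    with b show ?thesis by (auto dest: prd_eq)
  qed
qed

section \<open>The two subbiquandles and the multiple conjugation structure\<close>

lemma subbiquandle_support: "support \<noteq> {} \<Longrightarrow> subbiquandle support X us os"
  by (rule subbiquandleI) (simp_all add: support_under_iff support_over_iff subsetI support_closed)

lemma subbiquandle_compl_support: "X - support \<noteq> {} \<Longrightarrow> subbiquandle (X - support) X us os"
  by (rule subbiquandleI) (simp_all add: support_under_iff support_over_iff)

lemma class_subset: "C \<in> support // P \<Longrightarrow> C \<subseteq> support"
  using Union_quotient[OF equiv_support] by blast

lemma mcb_support:
  assumes "support \<noteq> {}"
  shows "multiple_conjugation_biquandle support us os (support // P) class_group"
proof (intro multiple_conjugation_biquandle.intro multiple_conjugation_biquandle_axioms.intro)
  show "biquandle support us os"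
    using subbiquandle_support[OF assms] by (simp add: subbiquandle_def)
  show "group (class_group C)" if "C \<in> support // P" for C
    using group_class_group[OF that] .
  show "disjoint_family_on (\<lambda>C. carrier (class_group C)) (support // P)"
    using quotient_disj[OF equiv_support] by (auto simp: disjoint_family_on_def)
  show "(\<Union>C\<in>support // P. carrier (class_group C)) = support"
    using Union_quotient[OF equiv_support] by simp
next
  fix C D x a
  assume C: "C \<in> support // P" and D: "D \<in> support // P" and x: "x \<in> support"
    and a: "a \<in> carrier (class_group C)"
  have aC: "a \<in> C" and xX: "x \<in> X" using a x support_closed by auto
  have CX: "c \<in> X" if "c \<in> C" for c using that C class_subset support_closed by blast
  show "(\<lambda>y. y \<star>\<^sub>u x) \<in> hom (class_group C) (class_group D)"
    if "a \<star>\<^sub>u x \<in> carrier (class_group D)"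
  proof (rule homI)
    \<comment> \<open>Translations preserve \<open>\<sim>\<close>, so one element of
      \<open>C\<close> landing in \<open>D\<close> forces all of \<open>C\<close> into
      \<open>D\<close>.\<close>
    fix c assume c: "c \<in> carrier (class_group C)"
    then have "a \<sim> c" using aC class_sim[OF C, of a c] by simp
    then have "a \<star>\<^sub>u x \<sim> c \<star>\<^sub>u x" using CX aC c xX sim_under_iff by simp
    then show "c \<star>\<^sub>u x \<in> carrier (class_group D)"
      using that class_sim[OF D, of "a \<star>\<^sub>u x"] by simp
  next
    fix b c assume "b \<in> carrier (class_group C)" "c \<in> carrier (class_group C)"
    then have "is_prod (b \<star>\<^sub>u x) (c \<star>\<^sub>u x) (prd b c \<star>\<^sub>u x)"
      using class_is_prod[OF C] is_prod_under xX by simp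
    then show "(b \<otimes>\<^bsub>class_group C\<^esub> c) \<star>\<^sub>u x = (b \<star>\<^sub>u x) \<otimes>\<^bsub>class_group D\<^esub> (c \<star>\<^sub>u x)"
      using prd_eq by simp
  qed
  show "(\<lambda>y. y \<star>\<^sub>o x) \<in> hom (class_group C) (class_group D)"
    if "a \<star>\<^sub>o x \<in> carrier (class_group D)"
  proof (rule homI)
    fix c assume c: "c \<in> carrier (class_group C)"
    then have "a \<sim> c" using aC class_sim[OF C, of a c] by simp
    then have "a \<star>\<^sub>o x \<sim> c \<star>\<^sub>o x" using CX aC c xX sim_over_iff by simp
    then show "c \<star>\<^sub>o x \<in> carrier (class_group D)"
      using that class_sim[OF D, of "a \<star>\<^sub>o x"] by simp
  next
    fix b c assume "b \<in> carrier (class_group C)" "c \<in> carrier (class_group C)"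
    then have "is_prod (b \<star>\<^sub>o x) (c \<star>\<^sub>o x) (prd b c \<star>\<^sub>o x)"
      using class_is_prod[OF C] is_prod_over xX by simp
    then show "(b \<otimes>\<^bsub>class_group C\<^esub> c) \<star>\<^sub>o x = (b \<star>\<^sub>o x) \<otimes>\<^bsub>class_group D\<^esub> (c \<star>\<^sub>o x)"
      using prd_eq by simp
  qed
next
  fix C a b
  assume C: "C \<in> support // P"
    and a: "a \<in> carrier (class_group C)" and b: "b \<in> carrier (class_group C)"
  interpret group "class_group C" using group_class_group[OF C] .
  have is_prod: "is_prod x y (x \<otimes>\<^bsub>class_group C\<^esub> y)"
    if "x \<in> carrier (class_group C)" "y \<in> carrier (class_group C)" for x y
    using class_is_prod(1)[OF C] that by simp
  \<comment> \<open>With these two facts, the next two axioms are (R5) for the pair formed by the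
    product and \<open>a\<close>, with \<open>\<triangle>\<close> evaluated as
    \<open>b \<star>\<^sub>o a\<close>.\<close>
  have ab: "a \<otimes>\<^bsub>class_group C\<^esub> b \<sim> a" "(a \<otimes>\<^bsub>class_group C\<^esub> b) \<triangle> a = b \<star>\<^sub>o a"
    using is_prod[OF a b] by (simp_all only: is_prod_def)
  show "x \<star>\<^sub>u (a \<otimes>\<^bsub>class_group C\<^esub> b) = (x \<star>\<^sub>u a) \<star>\<^sub>u (b \<star>\<^sub>o a)" if "x \<in> support" for x
    using under_under_tri[OF ab(1) support_closed[OF that]] unfolding ab(2) by (rule sym)
  show "x \<star>\<^sub>o (a \<otimes>\<^bsub>class_group C\<^esub> b) = (x \<star>\<^sub>o a) \<star>\<^sub>o (b \<star>\<^sub>o a)" if "x \<in> support" for x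
    using over_over_tri[OF ab(1) support_closed[OF that]] unfolding ab(2) by (rule sym)
  let ?l = "inv\<^bsub>class_group C\<^esub> a \<otimes>\<^bsub>class_group C\<^esub> b"
  let ?r = "b \<otimes>\<^bsub>class_group C\<^esub> inv\<^bsub>class_group C\<^esub> a"
  have l: "?l \<in> carrier (class_group C)" and r: "?r \<in> carrier (class_group C)"
    using a b by (blast intro: m_closed inv_closed)+
  \<comment> \<open>Writing \<open>b\<close> as a product with \<open>a\<close> on either side lets
    \<open>b \<triangle> a\<close> be computed twice: by the definition of \<open>is_prod\<close>
    when \<open>a\<close> is the left factor, by \<open>is_prod_iff_under\<close> when it is the
    right one.\<close>
  have "b = a \<otimes>\<^bsub>class_group C\<^esub> ?l" "b = ?r \<otimes>\<^bsub>class_group C\<^esub> a"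
    using inv_solve_left[OF l a b] inv_solve_right[OF r b a] by blast+
  then have "is_prod a ?l b" "is_prod ?r a b"
    using is_prod[OF a l] is_prod[OF r a] by argo+
  then have "b \<triangle> a = ?l \<star>\<^sub>o a" "b \<triangle> a = ?r \<star>\<^sub>u a"
    unfolding is_prod_def[of a] is_prod_iff_under[of _ a] by blast+
  then show "?l \<star>\<^sub>o a = ?r \<star>\<^sub>u a" by argo
qed

end

text \<open>A biquandle is non-empty by definition, whereas \<open>X1\<close> or \<open>X2\<close>
  may be empty, which explains the conditional claims. Each class serves as its own index.\<close>

theorem theorem7p1:
  fixes X X1 X2 :: "'a set"
    and us :: "'a \<Rightarrow> 'a \<Rightarrow> 'a" (infixl "\<star>\<^sub>u" 70)
    and os :: "'a \<Rightarrow> 'a \<Rightarrow> 'a" (infixl "\<star>\<^sub>o" 70)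
    and P :: "('a \<times> 'a) set"
    and tri :: "'a \<Rightarrow> 'a \<Rightarrow> 'a"
  assumes "primitive_biquandle X us os P tri"
    and "X1 = {b \<in> X. \<exists>a \<in> X. (a, b) \<in> P}"
    and "X2 = X - X1"
  shows "((X1 \<noteq> {} \<longrightarrow> subbiquandle X1 X us os) \<and>
          (X2 \<noteq> {} \<longrightarrow> subbiquandle X2 X us os) \<and>
          (\<forall>a \<in> X. (\<lambda>x. x \<star>\<^sub>u a) ` X1 = X1 \<and> (\<lambda>x. x \<star>\<^sub>o a) ` X1 = X1 \<and>
                   (\<lambda>x. x \<star>\<^sub>u a) ` X2 = X2 \<and> (\<lambda>x. x \<star>\<^sub>o a) ` X2 = X2))
       \<and> equiv X1 P
       \<and> (X1 \<noteq> {} \<longrightarrow>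
            (\<exists>G :: 'a set \<Rightarrow> 'a monoid.
               (\<forall>C \<in> X1 // P. carrier (G C) = C) \<and>
               multiple_conjugation_biquandle X1 us os (X1 // P) G))"
proof -
  interpret primitive_biquandle X us os P tri by fact
  have X1: "X1 = support" using assms(2) unfolding support_def .
  have sub: "support \<subseteq> X" using support_closed by (rule subsetI)
  show ?thesis
    unfolding assms(3) X1
  proof (intro conjI impI ballI)
    show "equiv support P" by (rule equiv_support)
    show "subbiquandle support X us os" if "support \<noteq> {}"
      using that by (rule subbiquandle_support)
    show "subbiquandle (X - support) X us os" if "X - support \<noteq> {}"
      using that by (rule subbiquandle_compl_support)
    show "\<exists>G :: 'a set \<Rightarrow> 'a monoid. (\<forall>C \<in> support // P. carrier (G C) = C) \<and>
        multiple_conjugation_biquandle support us os (support // P) G" if "support \<noteq> {}"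
      using mcb_support[OF that] carrier_class_group by (intro exI[of _ class_group] conjI ballI)
    fix a assume a: "a \<in> X"
    show "(\<lambda>x. x \<star>\<^sub>u a) ` support = support" "(\<lambda>x. x \<star>\<^sub>o a) ` support = support"
      using a by (simp_all add: under_image over_image sub support_under_iff support_over_iff)
    show "(\<lambda>x. x \<star>\<^sub>u a) ` (X - support) = X - support"
      "(\<lambda>x. x \<star>\<^sub>o a) ` (X - support) = X - support"
      using a by (simp_all add: under_image over_image support_under_iff support_over_iff)
  qed
qed

end
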